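(* There exists a finite partial monitoring game (finite $k$ and finite $\mathcal Z$) such that, in the Rustichini setting, $$\limsup_{n\to\infty}\frac{\log(\mathfrak R_n^\star)}{\log(n)}=\frac47.$$
   Context: A $k$-action partial monitoring game: set $\mathcal Z$, loss $\mathcal L:[k]\times\mathcal Z\to[0,1]$ (in the paper's example losses may take values up to $2$, which is immaterial after rescaling), signal $\mathcal S:[k]\times\mathcal Z\to\Sigma$. $\mathcal K$ = probability simplex on finite $\mathcal Z$; $\Delta_k$ = probability simplex on $[k]$; $\mathcal L(\pi,x)=\sum_{a,z}\pi(a)x(z)\mathcal L(a,z)$; $\mathcal S(a,x)$ = law of $\mathcal S(a,z)$, $z\sim x$. Rustichini setting: $x\,\mathrm R\,y$ iff $\mathcal S(a,x)=\mathcal S(a,y)$ for all $a$; $\mathcal V(\pi,x)=\sup_{y\,\mathrm R\,x}\mathcal L(\pi,y)$; $\mathcal V_\star(x)=\min_{\pi\in\Delta_k}\mathcal V(\pi,x)$. Interaction: adversary fixes $x_1,\dots,x_n\in\mathcal K$, $z_t\sim x_t$ independent and unobserved; learner chooses $\pi_t$ from past actions/signals, samples $a_t\sim\pi_t$, observes $\sigma_t=\mathcal S(a_t,z_t)$. Regret $\mathbb E[\sum_t\mathcal V(\pi_t,x_t)]-n\mathcal V_\star(\frac1n\sum_tx_t)$; $\mathfrak R_n^\star$ = infimum over learners of the supremum over adversary sequences of the regret. *)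

theory Defs
  imports "HOL-Analysis.Analysis" "HOL-Library.Liminf_Limsup"
begin

text \<open>A finite partial monitoring game: actions are 0..<k, outcomes are 0..<m,
  loss L a z, signal S a z (signals encoded as natural numbers).\<close>

definition prob_simplex :: "nat \<Rightarrow> (nat \<Rightarrow> real) set" where
  "prob_simplex N = {p. (\<forall>i. 0 \<le> p i) \<and> (\<forall>i\<ge>N. p i = 0) \<and> (\<Sum>i<N. p i) = 1}"

definition mix_loss :: "nat \<Rightarrow> nat \<Rightarrow> (nat \<Rightarrow> nat \<Rightarrow> real) \<Rightarrow> (nat \<Rightarrow> real) \<Rightarrow> (nat \<Rightarrow> real) \<Rightarrow> real" where
  "mix_loss k m L p x = (\<Sum>a<k. \<Sum>z<m. p a * x z * L a z)"

definition sig_law :: "nat \<Rightarrow> (nat \<Rightarrow> nat \<Rightarrow> nat) \<Rightarrow> nat \<Rightarrow> (nat \<Rightarrow> real) \<Rightarrow> nat \<Rightarrow> real" where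
  "sig_law m S a x \<sigma> = (\<Sum>z<m. if S a z = \<sigma> then x z else 0)"

definition sig_equiv :: "nat \<Rightarrow> nat \<Rightarrow> (nat \<Rightarrow> nat \<Rightarrow> nat) \<Rightarrow> (nat \<Rightarrow> real) \<Rightarrow> (nat \<Rightarrow> real) \<Rightarrow> bool" where
  "sig_equiv k m S x y \<longleftrightarrow> (\<forall>a<k. sig_law m S a x = sig_law m S a y)"

definition Vloss :: "nat \<Rightarrow> nat \<Rightarrow> (nat \<Rightarrow> nat \<Rightarrow> real) \<Rightarrow> (nat \<Rightarrow> nat \<Rightarrow> nat) \<Rightarrow> (nat \<Rightarrow> real) \<Rightarrow> (nat \<Rightarrow> real) \<Rightarrow> real" where
  "Vloss k m L S p x = (SUP y \<in> {y \<in> prob_simplex m. sig_equiv k m S y x}. mix_loss k m L p y)"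

definition Vstar :: "nat \<Rightarrow> nat \<Rightarrow> (nat \<Rightarrow> nat \<Rightarrow> real) \<Rightarrow> (nat \<Rightarrow> nat \<Rightarrow> nat) \<Rightarrow> (nat \<Rightarrow> real) \<Rightarrow> real" where
  "Vstar k m L S x = (INF p \<in> prob_simplex k. Vloss k m L S p x)"

text \<open>A learner maps the history of (action, signal) pairs to a distribution over actions.\<close>
type_synonym learner = "(nat \<times> nat) list \<Rightarrow> nat \<Rightarrow> real"

definition valid_learner :: "nat \<Rightarrow> learner \<Rightarrow> bool" where
  "valid_learner k lr \<longleftrightarrow> (\<forall>h. lr h \<in> prob_simplex k)"

text \<open>Expected value of the sum of V(pi_t, x_t) over the remaining rounds, given history h:
  a_t ~ pi_t, z_t ~ x_t independently, the learner observes S a_t z_t.\<close>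
fun exp_V :: "nat \<Rightarrow> nat \<Rightarrow> (nat \<Rightarrow> nat \<Rightarrow> real) \<Rightarrow> (nat \<Rightarrow> nat \<Rightarrow> nat) \<Rightarrow> learner
               \<Rightarrow> (nat \<Rightarrow> real) list \<Rightarrow> (nat \<times> nat) list \<Rightarrow> real" where
  "exp_V k m L S lr [] h = 0"
| "exp_V k m L S lr (x # xs) h =
     Vloss k m L S (lr h) x
     + (\<Sum>a<k. \<Sum>z<m. lr h a * x z * exp_V k m L S lr xs (h @ [(a, S a z)]))"

definition avg :: "(nat \<Rightarrow> real) list \<Rightarrow> nat \<Rightarrow> real" where
  "avg xs = (\<lambda>z. (\<Sum>x\<leftarrow>xs. x z) / real (length xs))"

definition regret :: "nat \<Rightarrow> nat \<Rightarrow> (nat \<Rightarrow> nat \<Rightarrow> real) \<Rightarrow> (nat \<Rightarrow> nat \<Rightarrow> nat) \<Rightarrow> learner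
                       \<Rightarrow> (nat \<Rightarrow> real) list \<Rightarrow> real" where
  "regret k m L S lr xs = exp_V k m L S lr xs [] - real (length xs) * Vstar k m L S (avg xs)"

definition minimax_regret :: "nat \<Rightarrow> nat \<Rightarrow> (nat \<Rightarrow> nat \<Rightarrow> real) \<Rightarrow> (nat \<Rightarrow> nat \<Rightarrow> nat) \<Rightarrow> nat \<Rightarrow> real" where
  "minimax_regret k m L S n =
     (INF lr \<in> {lr. valid_learner k lr}.
        SUP xs \<in> {xs. length xs = n \<and> set xs \<subseteq> prob_simplex m}. regret k m L S lr xs)"

end

theory Submission
  imports Defs "HOL-Real_Asymp.Real_Asymp"
begin

text \<open>Outcomes are pairs of bits; outcome \<open>z\<close> has first bit \<open>odd z\<close> and second bit \<open>2 \<le> z\<close>, with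
  probabilities \<open>u\<close> and \<open>v\<close> of being 1. Besides predicting the second bit, the learner pays for a
  conjunction. Actions 0 and 1 pay for both bits being 1, which the worst coupling turns into
  \<open>min u v\<close>, and reveal nothing. Actions 2 to 5 pay for one of the two bits and reveal the second
  bit. Action 6 is expensive and reveals the first bit. So the second bit can be observed for free
  by a learner who knows whether \<open>u\<close> or \<open>v\<close> is smaller, but this can only be learnt with action 6.

  Lower bound: take \<open>u = 1/2 \<plusminus> d\<close> and \<open>v = 1/2 \<plusminus> e\<close>. The product of the harmonic means of the
  likelihoods decreases by a factor \<open>1 - 4 * e^2\<close> when the second bit is observed, at cost about \<open>d\<close>,
  and by \<open>1 - 4 * d^2\<close> when the first bit is observed, at constant cost. With \<open>e\<close> and \<open>d\<close> of orders
  \<open>n powr (-3/7)\<close> and \<open>n powr (-2/7)\<close> neither kind of observation pays off, so that the error \<open>e\<close>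
  is suffered in all rounds.

  Upper bound: choose action 6 with probability \<open>g\<close> and actions 2 to 5 with probability \<open>p\<close>. Learning
  which of \<open>u\<close> and \<open>v\<close> is smaller has regret about \<open>sqrt (n / g)\<close>, but this is only paid with
  probability \<open>p\<close>; learning the second bit has regret \<open>sqrt (n / p)\<close>. The total
  \<open>n * g + p * sqrt (n / g) + sqrt (n / p)\<close> is balanced by \<open>g = n powr (-3/7)\<close> and
  \<open>p = n powr (-1/7)\<close>.\<close>

section \<open>The game: values, signals and boundedness of the regret\<close>

definition game_L :: "nat \<Rightarrow> nat \<Rightarrow> real" where
  "game_L a z =
     (if a < 6
      then (if a < 2 then of_bool (odd z \<and> 2 \<le> z) else if a < 4 then of_bool (odd z) else of_bool (2 \<le> z))
           + of_bool ((2 \<le> z) \<noteq> odd a)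
      else 2) / 2"

definition game_S :: "nat \<Rightarrow> nat \<Rightarrow> nat" where
  "game_S a z = (if a < 2 then 0 else if a < 6 then of_bool (2 \<le> z) else of_bool (odd z))"

lemma game_L_bounds: "0 \<le> game_L a z" "game_L a z \<le> 1"
  by (auto simp: game_L_def of_bool_def)

definition marg1 :: "(nat \<Rightarrow> real) \<Rightarrow> real" where "marg1 x = x 1 + x 3"
definition marg2 :: "(nat \<Rightarrow> real) \<Rightarrow> real" where "marg2 x = x 2 + x 3"

lemma sum_lessThan_4: "(\<Sum>i<4::nat. f i) = f 0 + f 1 + f 2 + (f 3 :: 'a::comm_monoid_add)"
  by (simp add: numeral_eq_Suc)

lemma sum_lessThan_7:
  "(\<Sum>i<7::nat. f i) = f 0 + f 1 + f 2 + f 3 + f 4 + f 5 + (f 6 :: 'a::comm_monoid_add)"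
  by (simp add: numeral_eq_Suc)

lemma simplex_4D:
  assumes "x \<in> prob_simplex 4"
  shows "0 \<le> x i" "x 0 + x 1 + x 2 + x 3 = 1"
  using assms by (auto simp: prob_simplex_def sum_lessThan_4)

lemma simplex_7D:
  assumes "p \<in> prob_simplex 7"
  shows "0 \<le> p i" "p 0 + p 1 + p 2 + p 3 + p 4 + p 5 + p 6 = 1"
  using assms by (auto simp: prob_simplex_def sum_lessThan_7)

lemma marg_bounds:
  assumes "x \<in> prob_simplex 4"
  shows "0 \<le> marg1 x" "marg1 x \<le> 1" "0 \<le> marg2 x" "marg2 x \<le> 1"
  using simplex_4D(1)[OF assms, of 0] simplex_4D(1)[OF assms, of 1] simplex_4D(1)[OF assms, of 2]
    simplex_4D(1)[OF assms, of 3] simplex_4D(2)[OF assms]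
  by (auto simp: marg1_def marg2_def)

text \<open>Closed form of the worst-case loss at marginals \<open>u\<close> and \<open>v\<close>.
  The parity of an action below 6 is its prediction of the second bit, so even ones pay
  \<open>v\<close> and odd ones \<open>1 - v\<close>; action 6 always pays the maximal loss
  1.\<close>

definition game_val :: "(nat \<Rightarrow> real) \<Rightarrow> real \<Rightarrow> real \<Rightarrow> real" where
  "game_val p u v = ((p 0 + p 1) * min u v + (p 2 + p 3) * u + (p 4 + p 5) * v + 2 * p 6
                     + (p 0 + p 2 + p 4) * v + (p 1 + p 3 + p 5) * (1 - v)) / 2"

lemma mix_loss_game:
  assumes "y \<in> prob_simplex 4"
  shows "mix_loss 7 4 game_L p y =
    ((p 0 + p 1) * y 3 + (p 2 + p 3) * marg1 y + (p 4 + p 5) * marg2 y + 2 * p 6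
      + (p 0 + p 2 + p 4) * marg2 y + (p 1 + p 3 + p 5) * (1 - marg2 y)) / 2"
proof -
  have y0: "y 0 = 1 - y 1 - y 2 - y 3"
    using simplex_4D(2)[OF assms] by simp
  show ?thesis
    unfolding mix_loss_def sum_lessThan_4 sum_lessThan_7 y0
    by (simp add: game_L_def marg1_def marg2_def field_simps)
qed

text \<open>No signal involves both bits, and actions 2 and 6 together reveal both marginals. The
  class of \<open>x\<close> is therefore the set of all couplings of its marginals.\<close>

lemma sig_equiv_game:
  assumes "x \<in> prob_simplex 4" "y \<in> prob_simplex 4"
  shows "sig_equiv 7 4 game_S y x \<longleftrightarrow> marg1 y = marg1 x \<and> marg2 y = marg2 x"
proof
  assume "sig_equiv 7 4 game_S y x"
  then have "sig_law 4 game_S 6 y 1 = sig_law 4 game_S 6 x 1"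
    "sig_law 4 game_S 2 y 1 = sig_law 4 game_S 2 x 1"
    by (auto simp: sig_equiv_def)
  then show "marg1 y = marg1 x \<and> marg2 y = marg2 x"
    by (simp add: sig_law_def sum_lessThan_4 game_S_def marg1_def marg2_def)
next
  assume m: "marg1 y = marg1 x \<and> marg2 y = marg2 x"
  have "sig_law 4 game_S a y \<sigma> = sig_law 4 game_S a x \<sigma>" for a \<sigma>
    using m simplex_4D(2)[OF assms(1)] simplex_4D(2)[OF assms(2)]
    by (auto simp: sig_law_def sum_lessThan_4 game_S_def marg1_def marg2_def)
  then show "sig_equiv 7 4 game_S y x"
    by (auto simp: sig_equiv_def)
qed

text \<open>The supremum over the unidentifiable coupling of the two bits is attained by the comonotone one.\<close>

lemma Vloss_game:
  assumes p: "p \<in> prob_simplex 7" and x: "x \<in> prob_simplex 4"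
  shows "Vloss 7 4 game_L game_S p x = game_val p (marg1 x) (marg2 x)"
proof -
  define u v where "u = marg1 x" and "v = marg2 x"
  define Y where "Y = {y \<in> prob_simplex 4. sig_equiv 7 4 game_S y x}"
  define y0 :: "nat \<Rightarrow> real" where
    "y0 = (\<lambda>z. if z = 0 then 1 - max u v else if z = 1 then u - min u v
               else if z = 2 then v - min u v else if z = 3 then min u v else 0)"
  have uv: "0 \<le> u" "u \<le> 1" "0 \<le> v" "v \<le> 1"
    using marg_bounds[OF x] by (auto simp: u_def v_def)
  have y0: "y0 \<in> prob_simplex 4"
    using uv by (auto simp: prob_simplex_def sum_lessThan_4 y0_def)
  have m0: "marg1 y0 = u" "marg2 y0 = v"
    by (auto simp: marg1_def marg2_def y0_def)
  have "y0 \<in> Y"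
    using y0 m0 sig_equiv_game[OF x y0] by (simp add: Y_def u_def v_def)
  moreover have "mix_loss 7 4 game_L p y0 = game_val p u v"
    unfolding mix_loss_game[OF y0] m0 game_val_def by (simp add: y0_def)
  moreover have "mix_loss 7 4 game_L p y \<le> game_val p u v" if "y \<in> Y" for y
  proof -
    have y: "y \<in> prob_simplex 4" and m: "marg1 y = u" "marg2 y = v"
      using that sig_equiv_game[OF x, of y] by (auto simp: Y_def u_def v_def)
    have "y 3 \<le> min u v"
      using simplex_4D(1)[OF y, of 1] simplex_4D(1)[OF y, of 2] m by (auto simp: marg1_def marg2_def)
    then have "(p 0 + p 1) * y 3 \<le> (p 0 + p 1) * min u v"
      using simplex_7D(1)[OF p] by (intro mult_left_mono) auto
    then show ?thesis
      unfolding mix_loss_game[OF y] m game_val_def by simp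
  qed
  ultimately have "(SUP y\<in>Y. mix_loss 7 4 game_L p y) = game_val p u v"
    by (intro cSup_eq_maximum) force+
  then show ?thesis
    by (simp add: Vloss_def Y_def u_def v_def)
qed

text \<open>The closed form of \<open>Vstar\<close>, attained by action 0 or 1 according to which
  value of the second bit is likelier.\<close>

definition game_opt :: "real \<Rightarrow> real \<Rightarrow> real" where
  "game_opt u v = (min u v + min v (1 - v)) / 2"

text \<open>Twice the difference of the sides is the sum of the five nonnegative terms below: the
  excess of actions 2 to 5 over \<open>min u v\<close>, that of action 6, and that of the two
  predictions.\<close>

lemma game_opt_le_val:
  assumes p: "p \<in> prob_simplex 7" and "0 \<le> u" "u \<le> 1" "0 \<le> v" "v \<le> 1"
  shows "game_opt u v \<le> game_val p u v"
proof -
  note nn = simplex_7D(1)[OF p]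
  have eq: "p 0 = 1 - (p 1 + p 2 + p 3 + p 4 + p 5 + p 6)"
    using simplex_7D(2)[OF p] by simp
  have "0 \<le> (p 2 + p 3) * (u - min u v)" "0 \<le> (p 4 + p 5) * (v - min u v)"
    "0 \<le> p 6 * (2 - min u v - min v (1 - v))"
    "0 \<le> (p 0 + p 2 + p 4) * (v - min v (1 - v))" "0 \<le> (p 1 + p 3 + p 5) * (1 - v - min v (1 - v))"
    using nn assms by (auto intro!: mult_nonneg_nonneg)
  then show ?thesis
    unfolding game_val_def game_opt_def eq by (simp add: field_simps)
qed

lemma game_opt_nonneg: "\<lbrakk>0 \<le> u; 0 \<le> v; v \<le> 1\<rbrakk> \<Longrightarrow> 0 \<le> game_opt u v"
  by (auto simp: game_opt_def)

lemma Vstar_ge: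
  assumes x: "x \<in> prob_simplex 4"
  shows "game_opt (marg1 x) (marg2 x) \<le> Vstar 7 4 game_L game_S x"
proof -
  have "(\<lambda>a::nat. if a = 0 then 1 else 0::real) \<in> prob_simplex 7"
    by (auto simp: prob_simplex_def sum_lessThan_7)
  then have "prob_simplex 7 \<noteq> {}" by blast
  then show ?thesis
    unfolding Vstar_def
    by (rule cINF_greatest) (simp add: Vloss_game x game_opt_le_val marg_bounds[OF x])
qed

lemma Vstar_le:
  assumes x: "x \<in> prob_simplex 4"
  shows "Vstar 7 4 game_L game_S x \<le> game_opt (marg1 x) (marg2 x)"
proof -
  define p :: "nat \<Rightarrow> real" where
    "p = (\<lambda>a. if a = (if marg2 x \<le> 1/2 then 0 else 1) then 1 else 0)"
  have p: "p \<in> prob_simplex 7"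
    by (auto simp: prob_simplex_def sum_lessThan_7 p_def)
  have "bdd_below ((\<lambda>p. Vloss 7 4 game_L game_S p x) ` prob_simplex 7)"
    by (rule bdd_belowI2[where m = "game_opt (marg1 x) (marg2 x)"])
      (simp add: Vloss_game x game_opt_le_val marg_bounds[OF x])
  then have "Vstar 7 4 game_L game_S x \<le> Vloss 7 4 game_L game_S p x"
    unfolding Vstar_def by (rule cINF_lower) (rule p)
  also have "\<dots> = game_opt (marg1 x) (marg2 x)"
    unfolding Vloss_game[OF p x] by (auto simp: game_val_def game_opt_def p_def)
  finally show ?thesis .
qed

lemma Vstar_game:
  "x \<in> prob_simplex 4 \<Longrightarrow> Vstar 7 4 game_L game_S x = game_opt (marg1 x) (marg2 x)"
  using Vstar_ge Vstar_le by (metis antisym)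

lemma game_val_le_1:
  assumes p: "p \<in> prob_simplex 7" and "0 \<le> u" "u \<le> 1" "0 \<le> v" "v \<le> 1"
  shows "game_val p u v \<le> 1"
proof -
  note nn = simplex_7D(1)[OF p]
  have eq: "p 6 = 1 - (p 0 + p 1 + p 2 + p 3 + p 4 + p 5)"
    using simplex_7D(2)[OF p] by simp
  have "0 \<le> (p 2 + p 3) * (1 - u)" "0 \<le> (p 4 + p 5) * (1 - v)"
    "0 \<le> (p 0 + p 1) * (1 - min u v)"
    "0 \<le> (p 0 + p 2 + p 4) * (1 - v)" "0 \<le> (p 1 + p 3 + p 5) * v"
    using nn assms by (auto intro!: mult_nonneg_nonneg)
  then show ?thesis
    unfolding game_val_def eq by (simp add: algebra_simps)
qed

text \<open>A continuation value \<open>W\<close> depends on the outcome only through one observed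
  bit, so the adversary enters the recursion for \<open>exp_V\<close> only through the two
  marginals. Both bounds rest on this.\<close>

lemma sum_signals_game:
  assumes x: "x \<in> prob_simplex 4"
  shows "(\<Sum>a<7. \<Sum>z<4. p a * x z * W a (game_S a z)) =
     p 0 * W 0 0 + p 1 * W 1 0
     + (\<Sum>a\<in>{2,3,4,5}. p a * (marg2 x * W a 1 + (1 - marg2 x) * W a 0))
     + p 6 * (marg1 x * W 6 1 + (1 - marg1 x) * W 6 0)"
proof -
  have x0: "x 0 = 1 - x 1 - x 2 - x 3"
    using simplex_4D(2)[OF x] by simp
  show ?thesis
    unfolding sum_lessThan_4 sum_lessThan_7 x0
    by (simp add: game_S_def marg1_def marg2_def algebra_simps)
qed

lemma exp_V_le_length:
  assumes lr: "valid_learner 7 lr" and "set xs \<subseteq> prob_simplex 4"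
  shows "exp_V 7 4 game_L game_S lr xs h \<le> real (length xs)"
  using assms(2)
proof (induction xs arbitrary: h)
  case (Cons x xs)
  have p: "lr h \<in> prob_simplex 7" and x: "x \<in> prob_simplex 4"
    using lr Cons.prems by (auto simp: valid_learner_def)
  have "(\<Sum>a<7. \<Sum>z<4. lr h a * x z * exp_V 7 4 game_L game_S lr xs (h @ [(a, game_S a z)]))
      \<le> (\<Sum>a<7. \<Sum>z<4. lr h a * x z * real (length xs))"
    using Cons simplex_7D(1)[OF p] simplex_4D(1)[OF x]
    by (intro sum_mono mult_left_mono mult_nonneg_nonneg) auto
  also have "\<dots> = (\<Sum>a<7. lr h a) * (\<Sum>z<4. x z) * real (length xs)"
    by (simp add: sum_product sum_distrib_left sum_distrib_right mult_ac)
  also have "\<dots> = real (length xs)"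
    using p x by (simp add: prob_simplex_def)
  finally show ?case
    using game_val_le_1[OF p marg_bounds[OF x]] by (simp add: Vloss_game p x)
qed simp

lemma avg_in_simplex:
  assumes "set xs \<subseteq> prob_simplex m" "xs \<noteq> []"
  shows "avg xs \<in> prob_simplex m"
proof -
  have "0 \<le> (\<Sum>x\<leftarrow>xs. x i)" for i
    using assms(1) by (intro sum_list_nonneg) (auto simp: prob_simplex_def)
  moreover have "(\<Sum>x\<leftarrow>xs. x i) = 0" if "m \<le> i" for i
    using assms(1) that by (induction xs) (auto simp: prob_simplex_def)
  moreover have "(\<Sum>i<m. \<Sum>x\<leftarrow>xs. x i) = real (length xs)"
    using assms(1) by (induction xs) (auto simp: prob_simplex_def sum.distrib)
  ultimately show ?thesis
    using assms(2) by (auto simp: prob_simplex_def avg_def sum_divide_distrib[symmetric])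
qed

lemma sum_list_marg:
  assumes "xs \<noteq> []"
  shows "(\<Sum>x\<leftarrow>xs. marg1 x) = real (length xs) * marg1 (avg xs)"
    "(\<Sum>x\<leftarrow>xs. marg2 x) = real (length xs) * marg2 (avg xs)"
  using assms by (simp_all add: marg1_def marg2_def avg_def sum_list_addf add_divide_distrib[symmetric])

lemma avg_replicate: "0 < n \<Longrightarrow> avg (replicate n x) = x"
  by (auto simp: avg_def sum_list_replicate)

text \<open>A real \<open>SUP\<close> dominates its elements only if they are bounded above; this
  permits bounding it from below by single adversaries.\<close>

lemma regret_bdd_above:
  assumes lr: "valid_learner 7 lr"
  shows "bdd_above (regret 7 4 game_L game_S lr ` {xs. length xs = n \<and> set xs \<subseteq> prob_simplex 4})"
proof (rule bdd_aboveI2[where M = "real n"])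
  fix xs :: "(nat \<Rightarrow> real) list"
  assume xs: "xs \<in> {xs. length xs = n \<and> set xs \<subseteq> prob_simplex 4}"
  show "regret 7 4 game_L game_S lr xs \<le> real n"
  proof (cases "xs = []")
    case False
    then have a: "avg xs \<in> prob_simplex 4"
      using xs by (intro avg_in_simplex) auto
    have "0 \<le> real (length xs) * Vstar 7 4 game_L game_S (avg xs)"
      using game_opt_nonneg marg_bounds[OF a] by (simp add: Vstar_game a)
    moreover have "exp_V 7 4 game_L game_S lr xs [] \<le> real n"
      using exp_V_le_length[OF lr, of xs "[]"] xs by simp
    ultimately show ?thesis
      by (simp add: regret_def)
  qed (simp add: regret_def)
qed

section \<open>Lower bound: four constant adversaries and harmonic means of likelihoods\<close>

definition indep_bits :: "real \<Rightarrow> real \<Rightarrow> nat \<Rightarrow> real" where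
  "indep_bits u v = (\<lambda>z. if z = 0 then (1 - u) * (1 - v) else if z = 1 then u * (1 - v)
                      else if z = 2 then (1 - u) * v else if z = 3 then u * v else 0)"

lemma indep_bits_simplex:
  "\<lbrakk>0 \<le> u; u \<le> 1; 0 \<le> v; v \<le> 1\<rbrakk> \<Longrightarrow> indep_bits u v \<in> prob_simplex 4"
  by (simp add: prob_simplex_def sum_lessThan_4 indep_bits_def) (simp add: algebra_simps)

lemma marg_indep_bits [simp]: "marg1 (indep_bits u v) = u" "marg2 (indep_bits u v) = v"
  by (auto simp: marg1_def marg2_def indep_bits_def algebra_simps)

text \<open>For likelihoods \<open>x\<close> and \<open>y\<close> of a history under two hypotheses,
  this measures the remaining confusion: it is below both, and it shrinks slowly under weakly
  informative observations.\<close>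

definition half_harm :: "real \<Rightarrow> real \<Rightarrow> real" where "half_harm x y = x * y / (x + y)"

lemma half_harm_facts:
  assumes "0 < x" "0 < y"
  shows "0 < half_harm x y" "half_harm x y \<le> x" "half_harm x y \<le> y" "4 * half_harm x y \<le> x + y"
proof -
  show "0 < half_harm x y" "half_harm x y \<le> x" "half_harm x y \<le> y"
    using assms by (auto simp: half_harm_def field_simps)
  have "0 \<le> (x - y)^2" by simp
  then have "4 * (x * y) \<le> (x + y) * (x + y)"
    by (simp add: power2_eq_square algebra_simps)
  then show "4 * half_harm x y \<le> x + y"
    using assms by (simp add: half_harm_def pos_divide_le_eq)
qed

text \<open>Either value of the observed bit multiplies the numerator by \<open>1/4 - d^2\<close>,
  while the two new denominators \<open>s\<close> and \<open>t\<close> add up to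
  \<open>x + y\<close>. Convexity of the reciprocal gives
  \<open>1 / s + 1 / t \<ge> 4 / (x + y)\<close>.\<close>

lemma half_harm_update:
  assumes "0 < x" "0 < y" "0 \<le> d" "d < 1/2"
  shows "(1 - 4 * d^2) * half_harm x y \<le>
    half_harm (x * (1/2 + d)) (y * (1/2 - d)) + half_harm (x * (1/2 - d)) (y * (1/2 + d))"
proof -
  define s t where "s = x * (1/2 + d) + y * (1/2 - d)" and "t = x * (1/2 - d) + y * (1/2 + d)"
  have s: "0 < s" and t: "0 < t"
    using assms by (auto simp: s_def t_def add_pos_pos)
  have st: "s + t = x + y" by (simp add: s_def t_def algebra_simps)
  have "0 \<le> (s - t)^2" by simp
  then have "4 * (s * t) \<le> (s + t) * (s + t)"
    by (simp add: power2_eq_square algebra_simps)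
  then have "4 / (s + t) \<le> (s + t) / (s * t)"
    using s t by (simp add: field_simps)
  also have "\<dots> = 1 / s + 1 / t"
    using s t by (simp add: field_simps)
  finally have le: "4 / (x + y) \<le> 1 / s + 1 / t" by (simp add: st)
  have d: "0 \<le> 1/4 - d^2"
    using assms power_mono[of d "1/2" 2] by (simp add: power2_eq_square)
  have "(1 - 4 * d^2) * half_harm x y = (1/4 - d^2) * (x * y) * (4 / (x + y))"
    by (simp add: half_harm_def)
  also have "\<dots> \<le> (1/4 - d^2) * (x * y) * (1 / s + 1 / t)"
    using assms d le by (intro mult_left_mono mult_nonneg_nonneg) auto
  also have "\<dots> = (x * (1/2 + d)) * (y * (1/2 - d)) / s + (x * (1/2 - d)) * (y * (1/2 + d)) / t"
    by (simp add: power2_eq_square algebra_simps add_divide_distrib diff_divide_distrib)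
  finally show ?thesis
    by (simp add: half_harm_def s_def t_def)
qed


definition gap_V :: "learner \<Rightarrow> nat \<Rightarrow> (nat \<times> nat) list \<Rightarrow> real \<Rightarrow> real \<Rightarrow> real" where
  "gap_V lr j h u v =
     exp_V 7 4 game_L game_S lr (replicate j (indep_bits u v)) h - real j * game_opt u v"

lemma gap_V_0 [simp]: "gap_V lr 0 h u v = 0"
  by (simp add: gap_V_def)

lemma gap_V_Suc:
  assumes lr: "valid_learner 7 lr" and uv: "0 \<le> u" "u \<le> 1" "0 \<le> v" "v \<le> 1"
  shows "gap_V lr (Suc j) h u v =
     (game_val (lr h) u v - game_opt u v)
     + (lr h 0 * gap_V lr j (h @ [(0, 0)]) u v + lr h 1 * gap_V lr j (h @ [(1, 0)]) u v
       + (\<Sum>a\<in>{2,3,4,5}. lr h a * (v * gap_V lr j (h @ [(a, 1)]) u v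
                                    + (1 - v) * gap_V lr j (h @ [(a, 0)]) u v))
       + lr h 6 * (u * gap_V lr j (h @ [(6, 1)]) u v + (1 - u) * gap_V lr j (h @ [(6, 0)]) u v))"
proof -
  have p: "lr h \<in> prob_simplex 7"
    using lr by (auto simp: valid_learner_def)
  have x: "indep_bits u v \<in> prob_simplex 4"
    using uv by (rule indep_bits_simplex)
  \<comment> \<open>Total mass one lets the constant \<open>real j * game_opt u v\<close> be
    distributed over the branches.\<close>
  have eq: "lr h 0 = 1 - (lr h 1 + lr h 2 + lr h 3 + lr h 4 + lr h 5 + lr h 6)"
    using simplex_7D(2)[OF p] by simp
  show ?thesis
    unfolding gap_V_def replicate_Suc exp_V.simps Vloss_game[OF p x] marg_indep_bits
      sum_signals_game[OF x, where W = "\<lambda>a \<sigma>. exp_V 7 4 game_L game_S lr (replicate j (indep_bits u v)) (h @ [(a, \<sigma>)])"] eq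
    by (simp add: algebra_simps)
qed

text \<open>The first bit has bias \<open>1/2 \<plusminus> d\<close> (likelihoods \<open>F1\<close>, \<open>F2\<close>), the second bias \<open>1/2 \<plusminus> e\<close>
  (likelihoods \<open>G1\<close>, \<open>G2\<close>).\<close>

definition gap4 :: "learner \<Rightarrow> real \<Rightarrow> real \<Rightarrow> nat \<Rightarrow> (nat \<times> nat) list \<Rightarrow>
    real \<Rightarrow> real \<Rightarrow> real \<Rightarrow> real \<Rightarrow> real" where
  "gap4 lr d e j h F1 F2 G1 G2 =
     F1 * G1 * gap_V lr j h (1/2 + d) (1/2 + e) + F1 * G2 * gap_V lr j h (1/2 + d) (1/2 - e)
     + F2 * G1 * gap_V lr j h (1/2 - d) (1/2 + e) + F2 * G2 * gap_V lr j h (1/2 - d) (1/2 - e)"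

text \<open>Bayes' rule without normalisation: an observed bit changes only the likelihoods of that
  bit, so the weights keep their product form and the recursion stays linear.\<close>

lemma gap4_Suc:
  fixes F1 F2 G1 G2 :: real and h :: "(nat \<times> nat) list"
  assumes lr: "valid_learner 7 lr" and "0 \<le> e" "e \<le> 1/2" "0 \<le> d" "d \<le> 1/2"
  defines "R \<equiv> \<lambda>u v. game_val (lr h) u v - game_opt u v"
  shows "gap4 lr d e (Suc j) h F1 F2 G1 G2 =
     (F1 * G1 * R (1/2 + d) (1/2 + e) + F1 * G2 * R (1/2 + d) (1/2 - e)
       + F2 * G1 * R (1/2 - d) (1/2 + e) + F2 * G2 * R (1/2 - d) (1/2 - e))
     + (lr h 0 * gap4 lr d e j (h @ [(0, 0)]) F1 F2 G1 G2
       + lr h 1 * gap4 lr d e j (h @ [(1, 0)]) F1 F2 G1 G2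
       + (\<Sum>a\<in>{2,3,4,5}. lr h a *
            (gap4 lr d e j (h @ [(a, 1)]) F1 F2 (G1 * (1/2 + e)) (G2 * (1/2 - e))
             + gap4 lr d e j (h @ [(a, 0)]) F1 F2 (G1 * (1/2 - e)) (G2 * (1/2 + e))))
       + lr h 6 *
            (gap4 lr d e j (h @ [(6, 1)]) (F1 * (1/2 + d)) (F2 * (1/2 - d)) G1 G2
             + gap4 lr d e j (h @ [(6, 0)]) (F1 * (1/2 - d)) (F2 * (1/2 + d)) G1 G2))"
proof -
  have c: "1 - (1/2 + t) = 1/2 - t" "1 - (1/2 - t) = 1/2 + t" for t :: real by simp_all
  define X where "X = (\<lambda>\<sigma> \<tau> a s. gap_V lr j (h @ [(a, s)]) (1/2 + \<sigma> * d) (1/2 + \<tau> * e))"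
  have X: "gap_V lr j (h @ [(a, s)]) (1/2 + d) (1/2 + e) = X 1 1 a s"
    "gap_V lr j (h @ [(a, s)]) (1/2 + d) (1/2 - e) = X 1 (-1) a s"
    "gap_V lr j (h @ [(a, s)]) (1/2 - d) (1/2 + e) = X (-1) 1 a s"
    "gap_V lr j (h @ [(a, s)]) (1/2 - d) (1/2 - e) = X (-1) (-1) a s" for a s
    by (simp_all add: X_def)
  define p where "p = lr h"
  have "0 \<le> 1/2 + t" "1/2 + t \<le> 1" "0 \<le> 1/2 - t" "1/2 - t \<le> 1" if "0 \<le> t" "t \<le> 1/2" for t :: real
    using that by auto
  note de = this[OF assms(4,5)] this[OF assms(2,3)]
  note g = gap_V_Suc[OF lr de(1,2,5,6), of j h] gap_V_Suc[OF lr de(1,2,7,8), of j h]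
    gap_V_Suc[OF lr de(3,4,5,6), of j h] gap_V_Suc[OF lr de(3,4,7,8), of j h]
  show ?thesis
    unfolding gap4_def g c X p_def[symmetric] R_def
    by (simp add: algebra_simps)
qed

text \<open>Every choice errs under some hypothesis: actions 2 and 3 when the first bit is the
  likelier one, 4 and 5 when it is not, each prediction under one sign of \<open>e\<close>, and
  action 6 always. \<open>half_harm\<close> bounds the weight of those hypotheses from
  below.\<close>

lemma gap4_cost:
  fixes F1 F2 G1 G2 :: real
  assumes p: "p \<in> prob_simplex 7" and pos: "0 < F1" "0 < F2" "0 < G1" "0 < G2"
    and "0 \<le> e" "2 * e \<le> d" "d \<le> 1/8"
  defines "R \<equiv> \<lambda>u v. game_val p u v - game_opt u v"
  shows "half_harm F1 F2 * half_harm G1 G2 * (4 * p 6 + d * (p 2 + p 3 + p 4 + p 5) + 4 * e * (1 - p 6))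
    \<le> F1 * G1 * R (1/2 + d) (1/2 + e) + F1 * G2 * R (1/2 + d) (1/2 - e)
       + F2 * G1 * R (1/2 - d) (1/2 + e) + F2 * G2 * R (1/2 - d) (1/2 - e)"
proof -
  note nn = simplex_7D(1)[OF p]
  define a1 a2 b q0 q1 where "a1 = p 2 + p 3" and "a2 = p 4 + p 5" and "b = p 6"
    and "q0 = p 0 + p 2 + p 4" and "q1 = p 1 + p 3 + p 5"
  have nn': "0 \<le> a1" "0 \<le> a2" "0 \<le> b" "0 \<le> q0" "0 \<le> q1"
    using nn by (auto simp: a1_def a2_def b_def q0_def q1_def)
  have b: "b = 1 - q0 - q1" and p01: "p 0 + p 1 = 1 - a1 - a2 - b"
    using simplex_7D(2)[OF p] by (auto simp: a1_def a2_def b_def q0_def q1_def)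
  have R: "R u v = (a1 * (u - min u v) + a2 * (v - min u v) + b * (2 - min u v - min v (1 - v))
      + q0 * (v - min v (1 - v)) + q1 * (1 - v - min v (1 - v))) / 2" for u v
  proof -
    have "R u v = ((1 - a1 - a2 - b) * min u v + a1 * u + a2 * v + 2 * b + q0 * v + q1 * (1 - v)
        - min u v - (b + q0 + q1) * min v (1 - v)) / 2"
      unfolding R_def game_val_def game_opt_def p01
      by (simp add: b a1_def[symmetric] a2_def[symmetric] b_def[symmetric] q0_def[symmetric] q1_def[symmetric]
          diff_divide_distrib add_divide_distrib del: One_nat_def)
    then show ?thesis by (simp add: algebra_simps)
  qed
  define H K where "H = half_harm F1 F2" and "K = half_harm G1 G2"
  have H: "0 < H" "H \<le> F1" "H \<le> F2" "4 * H \<le> F1 + F2" and K: "0 < K" "K \<le> G1" "K \<le> G2" "4 * K \<le> G1 + G2"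
    using half_harm_facts pos by (auto simp: H_def K_def)
  have R1: "R (1/2 + d) (1/2 + e) \<ge> (a1 * (d - e) + b / 2 + q0 * (2 * e)) / 2"
    and R2: "R (1/2 + d) (1/2 - e) \<ge> (a1 * (d - e) + b / 2 + q1 * (2 * e)) / 2"
    and R3: "R (1/2 - d) (1/2 + e) \<ge> (a2 * (d - e) + b / 2 + q0 * (2 * e)) / 2"
    and R4: "R (1/2 - d) (1/2 - e) \<ge> (a2 * (d - e) + b / 2 + q1 * (2 * e)) / 2"
  proof -
    have "a1 * (d - e) \<le> a1 * (d + e)" "a2 * (d - e) \<le> a2 * (d + e)"
      "b * (1/2) \<le> b * (1 + 2 * e)" "b * (1/2) \<le> b * (1 + d + e)"
      using nn' \<open>0 \<le> e\<close> \<open>2 * e \<le> d\<close> by - (rule mult_left_mono; simp)+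
    moreover have "R (1/2 + d) (1/2 + e) = (a1 * (d - e) + b + q0 * (2 * e)) / 2"
      "R (1/2 + d) (1/2 - e) = (a1 * (d + e) + b * (1 + 2 * e) + q1 * (2 * e)) / 2"
      "R (1/2 - d) (1/2 + e) = (a2 * (d + e) + b * (1 + d + e) + q0 * (2 * e)) / 2"
      "R (1/2 - d) (1/2 - e) = (a2 * (d - e) + b * (1 + d + e) + q1 * (2 * e)) / 2"
      unfolding R using \<open>0 \<le> e\<close> \<open>2 * e \<le> d\<close>
      by (simp_all add: min_absorb1 min_absorb2 add_ac)
    ultimately show "R (1/2 + d) (1/2 + e) \<ge> (a1 * (d - e) + b / 2 + q0 * (2 * e)) / 2"
      "R (1/2 + d) (1/2 - e) \<ge> (a1 * (d - e) + b / 2 + q1 * (2 * e)) / 2"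
      "R (1/2 - d) (1/2 + e) \<ge> (a2 * (d - e) + b / 2 + q0 * (2 * e)) / 2"
      "R (1/2 - d) (1/2 - e) \<ge> (a2 * (d - e) + b / 2 + q1 * (2 * e)) / 2"
      using nn' by auto
  qed
  \<comment> \<open>The smallest distance between the two marginals over the four
    hypotheses.\<close>
  define D where "D = d - e"
  have "d / 2 \<le> D" "0 \<le> D" using \<open>0 \<le> e\<close> \<open>2 * e \<le> d\<close> by (auto simp: D_def)
  \<comment> \<open>The right-hand sides are the total weights of the hypotheses on which the losses
    of actions 2 and 3, of 4 and 5, of action 6, and of the two predictions are incurred.\<close>
  have m: "4 * (H * K) \<le> F1 * (G1 + G2)" "4 * (H * K) \<le> F2 * (G1 + G2)"
    "16 * (H * K) \<le> (F1 + F2) * (G1 + G2)"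
    "4 * (H * K) \<le> (F1 + F2) * G1" "4 * (H * K) \<le> (F1 + F2) * G2"
    using mult_mono[of H F1 "4 * K" "G1 + G2"] mult_mono[of H F2 "4 * K" "G1 + G2"]
      mult_mono[of "4 * H" "F1 + F2" "4 * K" "G1 + G2"]
      mult_mono[of "4 * H" "F1 + F2" K G1] mult_mono[of "4 * H" "F1 + F2" K G2] H K pos
    by auto
  have "H * K * (4 * b + d * (a1 + a2) + 4 * e * (1 - b))
      = (a1 * ((d / 2) * (4 * (H * K))) + a2 * ((d / 2) * (4 * (H * K)))
         + b / 2 * (16 * (H * K)) + q0 * (2 * e * (4 * (H * K))) + q1 * (2 * e * (4 * (H * K)))) / 2"
    unfolding b by (simp add: field_simps)
  also have "\<dots> \<le> (a1 * (D * (F1 * (G1 + G2))) + a2 * (D * (F2 * (G1 + G2)))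
         + b / 2 * ((F1 + F2) * (G1 + G2)) + q0 * (2 * e * ((F1 + F2) * G1))
         + q1 * (2 * e * ((F1 + F2) * G2))) / 2"
  proof -
    have k1: "d / 2 * (4 * (H * K)) \<le> D * (F1 * (G1 + G2))" "d / 2 * (4 * (H * K)) \<le> D * (F2 * (G1 + G2))"
      using H(1) K(1) by (intro mult_mono[OF \<open>d / 2 \<le> D\<close> m(1) \<open>0 \<le> D\<close>] mult_mono[OF \<open>d / 2 \<le> D\<close> m(2) \<open>0 \<le> D\<close>]; simp)+
    have k2: "2 * e * (4 * (H * K)) \<le> 2 * e * ((F1 + F2) * G1)"
      "2 * e * (4 * (H * K)) \<le> 2 * e * ((F1 + F2) * G2)"
      using \<open>0 \<le> e\<close> by (intro mult_left_mono[OF m(4)] mult_left_mono[OF m(5)]; simp)+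
    have "0 \<le> b / 2" using nn'(3) by simp
    with k1 k2 m(3) nn' show ?thesis
      by (intro divide_right_mono add_mono k1[THEN mult_left_mono] k2[THEN mult_left_mono]
          m(3)[THEN mult_left_mono]) simp_all
  qed
  also have "\<dots> = F1 * G1 * ((a1 * D + b / 2 + q0 * (2 * e)) / 2) + F1 * G2 * ((a1 * D + b / 2 + q1 * (2 * e)) / 2)
      + F2 * G1 * ((a2 * D + b / 2 + q0 * (2 * e)) / 2) + F2 * G2 * ((a2 * D + b / 2 + q1 * (2 * e)) / 2)"
    by (simp add: field_simps)
  also have "\<dots> \<le> F1 * G1 * R (1/2 + d) (1/2 + e) + F1 * G2 * R (1/2 + d) (1/2 - e)
       + F2 * G1 * R (1/2 - d) (1/2 + e) + F2 * G2 * R (1/2 - d) (1/2 - e)"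
    using pos unfolding D_def by (intro add_mono mult_left_mono R1 R2 R3 R4) auto
  finally show ?thesis
    by (simp add: H_def K_def a1_def a2_def b_def add.assoc)
qed

text \<open>Backward induction with arbitrary likelihoods: each round adds \<open>4 * e\<close>
  times the confusion. An observation lowers the value of the later rounds by a factor
  \<open>1 - 4 * e^2\<close> or \<open>1 - 4 * d^2\<close>, and \<open>small\<close> says that its
  price exceeds this gain.\<close>

lemma gap4_ge:
  assumes lr: "valid_learner 7 lr" and e: "0 \<le> e" "2 * e \<le> d" "d \<le> 1/8"
    and small: "4 * d^2 * (4 * e * real n) \<le> 1" "4 * e^2 * (4 * e * real n) \<le> d"
    and "j \<le> n" "0 < F1" "0 < F2" "0 < G1" "0 < G2"
  shows "4 * e * real j * (half_harm F1 F2 * half_harm G1 G2) \<le> gap4 lr d e j h F1 F2 G1 G2"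
  using assms(7-)
proof (induction j arbitrary: h F1 F2 G1 G2)
  case 0
  then show ?case by (simp add: gap4_def)
next
  case (Suc j)
  have p: "lr h \<in> prob_simplex 7"
    using lr by (auto simp: valid_learner_def)
  note nn = simplex_7D(1)[OF p]
  define p where "p = lr h"
  define \<kappa> where "\<kappa> = 4 * e * real j"
  define H K where "H = half_harm F1 F2" and "K = half_harm G1 G2"
  have H: "0 < H" and K: "0 < K"
    using half_harm_facts Suc.prems by (auto simp: H_def K_def)
  have \<kappa>: "0 \<le> \<kappa>" "\<kappa> \<le> 4 * e * real n"
    using e Suc.prems by (auto simp: \<kappa>_def intro!: mult_left_mono)
  have d: "d < 1/2" "0 \<le> d" "e < 1/2" using e by auto
  have IH: "\<kappa> * (half_harm F1 F2 * half_harm G1 G2) \<le> gap4 lr d e j h F1 F2 G1 G2"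
    if "0 < F1" "0 < F2" "0 < G1" "0 < G2" for h F1 F2 G1 G2
    using Suc.IH that Suc.prems by (simp add: \<kappa>_def)
  have I0: "\<kappa> * (H * K) \<le> gap4 lr d e j h F1 F2 G1 G2" for h
    using IH Suc.prems by (simp add: H_def K_def)
  have I1: "\<kappa> * ((1 - 4 * e^2) * (H * K)) \<le>
      gap4 lr d e j h F1 F2 (G1 * (1/2 + e)) (G2 * (1/2 - e))
      + gap4 lr d e j h' F1 F2 (G1 * (1/2 - e)) (G2 * (1/2 + e))" for h h'
  proof -
    have "\<kappa> * H * ((1 - 4 * e^2) * K) \<le> \<kappa> * H *
        (half_harm (G1 * (1/2 + e)) (G2 * (1/2 - e)) + half_harm (G1 * (1/2 - e)) (G2 * (1/2 + e)))"
      using half_harm_update[of G1 G2 e] Suc.prems d e(1) \<kappa> H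
      by (intro mult_left_mono) (auto simp: K_def)
    also have "\<dots> = \<kappa> * (H * half_harm (G1 * (1/2 + e)) (G2 * (1/2 - e)))
        + \<kappa> * (H * half_harm (G1 * (1/2 - e)) (G2 * (1/2 + e)))"
      by (simp add: algebra_simps)
    also have "\<dots> \<le> gap4 lr d e j h F1 F2 (G1 * (1/2 + e)) (G2 * (1/2 - e))
      + gap4 lr d e j h' F1 F2 (G1 * (1/2 - e)) (G2 * (1/2 + e))"
      unfolding H_def using Suc.prems d e(1) by (intro add_mono IH) auto
    finally show ?thesis by (simp add: mult_ac)
  qed
  have I2: "\<kappa> * ((1 - 4 * d^2) * (H * K)) \<le>
      gap4 lr d e j h (F1 * (1/2 + d)) (F2 * (1/2 - d)) G1 G2
      + gap4 lr d e j h' (F1 * (1/2 - d)) (F2 * (1/2 + d)) G1 G2" for h h'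
  proof -
    have "\<kappa> * K * ((1 - 4 * d^2) * H) \<le> \<kappa> * K *
        (half_harm (F1 * (1/2 + d)) (F2 * (1/2 - d)) + half_harm (F1 * (1/2 - d)) (F2 * (1/2 + d)))"
      using half_harm_update[of F1 F2 d] Suc.prems d \<kappa> K
      by (intro mult_left_mono) (auto simp: H_def)
    also have "\<dots> = \<kappa> * (half_harm (F1 * (1/2 + d)) (F2 * (1/2 - d)) * K)
        + \<kappa> * (half_harm (F1 * (1/2 - d)) (F2 * (1/2 + d)) * K)"
      by (simp add: algebra_simps)
    also have "\<dots> \<le> gap4 lr d e j h (F1 * (1/2 + d)) (F2 * (1/2 - d)) G1 G2
      + gap4 lr d e j h' (F1 * (1/2 - d)) (F2 * (1/2 + d)) G1 G2"
      unfolding K_def using Suc.prems d by (intro add_mono IH) auto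
    finally show ?thesis by (simp add: mult_ac)
  qed
  define a b where "a = p 2 + p 3 + p 4 + p 5" and "b = p 6"
  have ab: "0 \<le> a" "0 \<le> b" "p 0 + p 1 = 1 - a - b"
    using nn simplex_7D(2)[OF \<open>lr h \<in> _\<close>] by (auto simp: a_def b_def p_def)
  have "4 * d^2 * \<kappa> \<le> 1" "4 * e^2 * \<kappa> \<le> d"
    using mult_left_mono[OF \<kappa>(2), of "4 * d^2"] mult_left_mono[OF \<kappa>(2), of "4 * e^2"] small
    by (auto simp: algebra_simps)
  \<comment> \<open>The price 4 of action 6 covers both the information gained and the prediction
    error avoided in this round; the price \<open>d\<close> of actions 2 to 5 covers their
    information.\<close>
  then have "b * (4 * d^2 * \<kappa> + 4 * e) \<le> b * 4" "a * (4 * e^2 * \<kappa>) \<le> a * d"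
    using ab e by (auto intro!: mult_left_mono)
  then have "\<kappa> + 4 * e \<le> (4 * b + d * a + 4 * e * (1 - b))
      + (\<kappa> * (1 - a - b) + a * (\<kappa> * (1 - 4 * e^2)) + b * (\<kappa> * (1 - 4 * d^2)))"
    by (simp add: algebra_simps)
  then have "(\<kappa> + 4 * e) * (H * K) \<le> ((4 * b + d * a + 4 * e * (1 - b))
      + (\<kappa> * (1 - a - b) + a * (\<kappa> * (1 - 4 * e^2)) + b * (\<kappa> * (1 - 4 * d^2)))) * (H * K)"
    using H K by (intro mult_right_mono) auto
  also have "\<dots> = H * K * (4 * p 6 + d * (p 2 + p 3 + p 4 + p 5) + 4 * e * (1 - p 6))
     + (p 0 * (\<kappa> * (H * K)) + p 1 * (\<kappa> * (H * K))
       + (\<Sum>a\<in>{2,3,4,5}. p a * (\<kappa> * ((1 - 4 * e^2) * (H * K)))) + p 6 * (\<kappa> * ((1 - 4 * d^2) * (H * K))))"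
    unfolding ab(3)[symmetric] by (simp add: a_def b_def algebra_simps)
  also have "\<dots> \<le> gap4 lr d e (Suc j) h F1 F2 G1 G2"
    unfolding gap4_Suc[OF lr e(1) less_imp_le[OF d(3)] d(2) less_imp_le[OF d(1)]] p_def[symmetric]
    using gap4_cost[OF \<open>lr h \<in> _\<close> Suc.prems(2-) e] nn
    by (intro add_mono sum_mono mult_left_mono I0 I1 I2) (auto simp: H_def K_def p_def)
  finally show ?case
    by (simp add: \<kappa>_def H_def K_def algebra_simps)
qed

text \<open>The supremum is at least the average regret against the four constant adversaries, which
  is a quarter of \<open>gap4\<close> with unit likelihoods.\<close>

lemma regret_lower:
  assumes lr: "valid_learner 7 lr" and n: "0 < n"
  shows "real n powr (4/7) / 64 \<le>
    (SUP xs \<in> {xs. length xs = n \<and> set xs \<subseteq> prob_simplex 4}. regret 7 4 game_L game_S lr xs)"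
    (is "_ \<le> ?s")
proof -
  define N where "N = real n powr (1/7)"
  have N: "1 \<le> N" and N7: "N ^ 7 = real n" and N4: "N ^ 4 = real n powr (4/7)"
    using n by (auto simp: N_def ge_one_powr_ge_zero powr_power)
  \<comment> \<open>Then \<open>e * n\<close> has order \<open>N ^ 4\<close>,
    \<open>d^2 * N ^ 4\<close> is constant and \<open>e^2 * N ^ 4\<close> has the order of
    \<open>d\<close>: both conditions in \<open>small\<close> are tight up to constants.\<close>
  define e d where "e = 1 / (16 * N ^ 3)" and "d = 1 / (8 * N ^ 2)"
  have e: "0 \<le> e" "2 * e \<le> d" "d \<le> 1/8"
    using N by (auto simp: e_def d_def field_simps power_increasing)
  have en: "4 * e * real n = N ^ 4 / 4"
    using N unfolding N7[symmetric] e_def by (simp add: field_simps power_add[symmetric])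
  have small: "4 * d^2 * (4 * e * real n) \<le> 1" "4 * e^2 * (4 * e * real n) \<le> d"
    unfolding en using N by (auto simp: e_def d_def field_simps power_add[symmetric] power_mult[symmetric])
  have le: "gap_V lr n [] u v \<le> ?s" if "0 \<le> u" "u \<le> 1" "0 \<le> v" "v \<le> 1" for u v
  proof -
    have x: "indep_bits u v \<in> prob_simplex 4"
      using that by (rule indep_bits_simplex)
    have "gap_V lr n [] u v = regret 7 4 game_L game_S lr (replicate n (indep_bits u v))"
      using n by (simp add: gap_V_def regret_def avg_replicate Vstar_game[OF x])
    also have "\<dots> \<le> ?s"
      using x by (intro cSUP_upper regret_bdd_above lr) auto
    finally show ?thesis .
  qed
  have "N ^ 4 / 16 = 4 * e * real n * (half_harm 1 1 * half_harm 1 1)"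
    unfolding en by (simp add: half_harm_def)
  also have "\<dots> \<le> gap4 lr d e n [] 1 1 1 1"
    by (intro gap4_ge[OF lr e small]) auto
  also have "\<dots> \<le> 4 * ?s"
    using le[of "1/2 + d" "1/2 + e"] le[of "1/2 + d" "1/2 - e"]
      le[of "1/2 - d" "1/2 + e"] le[of "1/2 - d" "1/2 - e"] e by (simp add: gap4_def)
  finally show ?thesis by (simp add: N4)
qed


section \<open>Upper bound: projected gradient descent with importance weights\<close>

definition clip :: "real \<Rightarrow> real" where "clip t = max 0 (min 1 t)"

lemma clip_bounds [simp]: "0 \<le> clip t" "clip t \<le> 1"
  by (auto simp: clip_def)

lemma clip_dist_le: "\<lbrakk>0 \<le> s; s \<le> 1\<rbrakk> \<Longrightarrow> (clip t - s)^2 \<le> (t - s)^2"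
  by (intro abs_le_square_iff[THEN iffD1]) (auto simp: clip_def)

text \<open>\<open>r\<close> estimates which of the two bits is less likely to be 1, and \<open>q\<close> is the probability of
  predicting that the second bit is 1. Both follow projected online gradient descent with
  importance-weighted gradients; \<open>g\<close> and \<open>p\<close> are the probabilities of observing each bit.\<close>

definition upd :: "real \<Rightarrow> real \<Rightarrow> real \<Rightarrow> real \<Rightarrow> real \<times> real \<Rightarrow> nat \<times> nat \<Rightarrow> real \<times> real" where
  "upd g p \<eta> \<theta> = (\<lambda>(r, q) (a, \<sigma>).
     if a < 2 then (r, q)
     else if a < 6 then (clip (r + \<eta> * real \<sigma> / p), clip (q - \<theta> * (1 - 2 * real \<sigma>) / p))
     else (clip (r - \<eta> * real \<sigma> / g), q))"

definition ogd_state :: "real \<Rightarrow> real \<Rightarrow> real \<Rightarrow> real \<Rightarrow> (nat \<times> nat) list \<Rightarrow> real \<times> real" where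
  "ogd_state g p \<eta> \<theta> h = foldl (upd g p \<eta> \<theta>) (1/2, 1/2) h"

lemma ogd_state_snoc: "ogd_state g p \<eta> \<theta> (h @ [y]) = upd g p \<eta> \<theta> (ogd_state g p \<eta> \<theta> h) y"
  by (simp add: ogd_state_def)

lemma ogd_state_bounds:
  "ogd_state g p \<eta> \<theta> h = (r, q) \<Longrightarrow> 0 \<le> r \<and> r \<le> 1 \<and> 0 \<le> q \<and> q \<le> 1"
proof (induction h arbitrary: r q rule: rev_induct)
  case Nil
  then show ?case by (auto simp: ogd_state_def)
next
  case (snoc y h)
  obtain r' q' where "ogd_state g p \<eta> \<theta> h = (r', q')" by fastforce
  with snoc show ?case
    by (cases y) (auto simp: ogd_state_snoc upd_def split: if_splits)
qed

text \<open>The groups 0-1, 2-5 and 6 have fixed probabilities \<open>1 - g - p\<close>,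
  \<open>p\<close> and \<open>g\<close>, so the importance weights do not depend on the state.
  Within 2-5, \<open>r\<close> is the probability of paying for the first bit; the prediction is
  drawn independently.\<close>

definition ogd_strategy :: "real \<Rightarrow> real \<Rightarrow> real \<times> real \<Rightarrow> nat \<Rightarrow> real" where
  "ogd_strategy g p = (\<lambda>(r, q) a.
     if a = 0 then (1 - g - p) * (1 - q) else if a = 1 then (1 - g - p) * q
     else if a = 2 then p * r * (1 - q) else if a = 3 then p * r * q
     else if a = 4 then p * (1 - r) * (1 - q) else if a = 5 then p * (1 - r) * q
     else if a = 6 then g else 0)"

definition ogd_learner :: "real \<Rightarrow> real \<Rightarrow> real \<Rightarrow> real \<Rightarrow> learner" where
  "ogd_learner g p \<eta> \<theta> h = ogd_strategy g p (ogd_state g p \<eta> \<theta> h)"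

lemma ogd_strategy_simplex:
  assumes "0 \<le> g" "0 \<le> p" "g + p \<le> 1" "0 \<le> r" "r \<le> 1" "0 \<le> q" "q \<le> 1"
  shows "ogd_strategy g p (r, q) \<in> prob_simplex 7"
  using assms
  by (auto simp: prob_simplex_def sum_lessThan_7 ogd_strategy_def intro!: mult_nonneg_nonneg)
    (simp add: algebra_simps)

lemma valid_ogd_learner:
  assumes "0 \<le> g" "0 \<le> p" "g + p \<le> 1"
  shows "valid_learner 7 (ogd_learner g p \<eta> \<theta>)"
  unfolding valid_learner_def ogd_learner_def
  using ogd_strategy_simplex[OF assms] ogd_state_bounds by (metis prod.exhaust)

text \<open>The usual squared distance to a comparator \<open>(s, t)\<close>. The part of
  \<open>r\<close> carries a factor \<open>p\<close> because the choice it governs is made only with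
  that probability; the outer half matches the scaling of the losses.\<close>

definition ogd_pot :: "real \<Rightarrow> real \<Rightarrow> real \<Rightarrow> real \<Rightarrow> real \<Rightarrow> real \<times> real \<Rightarrow> real" where
  "ogd_pot p \<eta> \<theta> s t = (\<lambda>(r, q). (p * (r - s)^2 / (2 * \<eta>) + (q - t)^2 / (2 * \<theta>)) / 2)"

text \<open>The loss with the comparator in place of the state, plus the exploration cost
  \<open>2 * g\<close> and bounds on the second moments of the gradient estimates.\<close>

definition ogd_cost :: "real \<Rightarrow> real \<Rightarrow> real \<Rightarrow> real \<Rightarrow> real \<Rightarrow> real \<Rightarrow> real \<Rightarrow> real \<Rightarrow> real" where
  "ogd_cost g p \<eta> \<theta> s t u v =
     ((1 - g - p) * min u v + p * (s * u + (1 - s) * v) + 2 * g + (t * (1 - v) + (1 - t) * v)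
      + p * \<eta> / 2 * (1 / p + 1 / g) + \<theta> / (2 * p)) / 2"

text \<open>The linear part of the expected change of potential turns the loss at
  \<open>(r, q)\<close> into that at \<open>(s, t)\<close>; the quadratic part gives the second
  moments; clipping only brings the state closer to the comparator.\<close>

lemma ogd_step:
  assumes gp: "0 < g" "0 < p" "g + p \<le> 1" and \<eta>: "0 < \<eta>" "0 < \<theta>"
    and rq: "0 \<le> r" "r \<le> 1" "0 \<le> q" "q \<le> 1" and st: "0 \<le> s" "s \<le> 1" "0 \<le> t" "t \<le> 1"
    and uv: "0 \<le> u" "u \<le> 1" "0 \<le> v" "v \<le> 1"
  defines "P \<equiv> ogd_pot p \<eta> \<theta> s t" and "U \<equiv> upd g p \<eta> \<theta> (r, q)" and "\<pi> \<equiv> ogd_strategy g p (r, q)"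
  shows "game_val \<pi> u v
     + (\<pi> 0 * P (U (0, 0)) + \<pi> 1 * P (U (1, 0))
        + (\<Sum>a\<in>{2,3,4,5}. \<pi> a * (v * P (U (a, 1)) + (1 - v) * P (U (a, 0))))
        + \<pi> 6 * (u * P (U (6, 1)) + (1 - u) * P (U (6, 0))))
     \<le> ogd_cost g p \<eta> \<theta> s t u v + P (r, q)"
proof -
  define A B where "A = (r - s)^2" and "B = (q - t)^2"
  define P' where "P' = (\<lambda>x y. (p * x / (2 * \<eta>) + y / (2 * \<theta>)) / 2)"
  have P'_mono: "P' x y \<le> P' x' y'" if "x \<le> x'" "y \<le> y'" for x y x' y'
    unfolding P'_def using that gp \<eta>
    by (intro divide_right_mono add_mono mult_left_mono) auto
  have P: "P (x, y) = P' ((x - s)^2) ((y - t)^2)" for x y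
    by (simp add: P_def P'_def ogd_pot_def)
  have P0: "P (U (a, 0)) = P' A B" if "a = 0 \<or> a = 1" for a
    using that by (auto simp: U_def upd_def P A_def B_def)
  have PA1: "P (U (a, 1)) \<le> P' ((r + \<eta> / p - s)^2) ((q + \<theta> / p - t)^2)" if "a \<in> {2,3,4,5}" for a
    using that clip_dist_le st by (auto simp: U_def upd_def P intro!: P'_mono)
  have PA0: "P (U (a, 0)) \<le> P' A ((q - \<theta> / p - t)^2)" if "a \<in> {2,3,4,5}" for a
    using that clip_dist_le[of s r] clip_dist_le[of t] st by (auto simp: U_def upd_def P A_def intro!: P'_mono)
  have PB1: "P (U (6, 1)) \<le> P' ((r - \<eta> / g - s)^2) B"
    using clip_dist_le st by (auto simp: U_def upd_def P B_def intro!: P'_mono)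
  have PB0: "P (U (6, 0)) \<le> P' A B"
    using clip_dist_le[of s r] st by (auto simp: U_def upd_def P A_def B_def intro!: P'_mono)
  have \<pi>: "0 \<le> \<pi> a" for a
    unfolding \<pi>_def using ogd_strategy_simplex[of g p r q] gp rq simplex_7D(1) by auto
  have e: "\<pi> 0 + \<pi> 1 = 1 - g - p" and a: "\<pi> 2 + \<pi> 3 + \<pi> 4 + \<pi> 5 = p" and g: "\<pi> 6 = g"
    by (simp_all add: \<pi>_def ogd_strategy_def algebra_simps)
  define A1 A0 B1 where "A1 = P' ((r + \<eta> / p - s)^2) ((q + \<theta> / p - t)^2)"
    and "A0 = P' A ((q - \<theta> / p - t)^2)" and "B1 = P' ((r - \<eta> / g - s)^2) B"
  have "\<pi> 0 * P (U (0, 0)) + \<pi> 1 * P (U (1, 0))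
        + (\<Sum>a\<in>{2,3,4,5}. \<pi> a * (v * P (U (a, 1)) + (1 - v) * P (U (a, 0))))
        + \<pi> 6 * (u * P (U (6, 1)) + (1 - u) * P (U (6, 0)))
     \<le> \<pi> 0 * P' A B + \<pi> 1 * P' A B
        + (\<Sum>a\<in>{2,3,4,5}. \<pi> a * (v * A1 + (1 - v) * A0))
        + \<pi> 6 * (u * B1 + (1 - u) * P' A B)"
    unfolding A1_def A0_def B1_def
    using \<pi> uv by (intro add_mono sum_mono mult_left_mono PA1 PA0 PB1 PB0 order_eq_refl[OF P0]) auto
  also have "\<dots> = (\<pi> 0 + \<pi> 1) * P' A B + (\<pi> 2 + \<pi> 3 + \<pi> 4 + \<pi> 5) * (v * A1 + (1 - v) * A0)
      + \<pi> 6 * (u * B1 + (1 - u) * P' A B)"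
    by (simp add: algebra_simps)
  also have "\<dots> = P' A B + (p * ((r - s) * (v - u) + \<eta> / 2 * (v / p + u / g))
      + (- (q - t) * (1 - 2 * v) + \<theta> / (2 * p))) / 2"
  proof -
    \<comment> \<open>A step of length \<open>d / y\<close> taken with probability \<open>y\<close>
      has a drift free of \<open>y\<close> and second moment \<open>d^2 / y\<close>.\<close>
    have sq: "y * (c + d / y)^2 = y * c^2 + 2 * d * c + d^2 / y"
      "y * (c - d / y)^2 = y * c^2 - 2 * d * c + d^2 / y" if "0 < y" for y c d :: real
      using that by (simp_all add: power2_eq_square field_simps)
    have X: "(1 - g - p) * A + (v * (p * (r - s + \<eta> / p)^2) + (1 - v) * (p * A))
        + (u * (g * (r - s - \<eta> / g)^2) + (1 - u) * (g * A))
        = A + 2 * \<eta> * (r - s) * (v - u) + \<eta>^2 * (v / p + u / g)"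
      unfolding sq[OF gp(1)] sq[OF gp(2)] A_def by (simp add: algebra_simps)
    have Y: "(1 - g - p) * B + (v * (p * (q - t + \<theta> / p)^2) + (1 - v) * (p * (q - t - \<theta> / p)^2)) + g * B
        = B - 2 * \<theta> * (q - t) * (1 - 2 * v) + \<theta>^2 / p"
      unfolding sq[OF gp(2)] B_def by (simp add: algebra_simps add_divide_distrib diff_divide_distrib)
    define c1 c2 where "c1 = p / (4 * \<eta>)" and "c2 = 1 / (4 * \<theta>)"
    have P'_lin: "P' x y = c1 * x + c2 * y" for x y
      by (simp add: P'_def c1_def c2_def add_divide_distrib)
    have "(1 - g - p) * P' A B + p * (v * A1 + (1 - v) * A0) + g * (u * B1 + (1 - u) * P' A B)
      = c1 * ((1 - g - p) * A + (v * (p * (r - s + \<eta> / p)^2) + (1 - v) * (p * A))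
          + (u * (g * (r - s - \<eta> / g)^2) + (1 - u) * (g * A)))
        + c2 * ((1 - g - p) * B + (v * (p * (q - t + \<theta> / p)^2) + (1 - v) * (p * (q - t - \<theta> / p)^2)) + g * B)"
    proof -
      have "r + \<eta> / p - s = r - s + \<eta> / p" "r - \<eta> / g - s = r - s - \<eta> / g"
        "q + \<theta> / p - t = q - t + \<theta> / p" "q - \<theta> / p - t = q - t - \<theta> / p"
        by simp_all
      then have eqs: "A1 = c1 * (r - s + \<eta> / p)^2 + c2 * (q - t + \<theta> / p)^2"
        "A0 = c1 * A + c2 * (q - t - \<theta> / p)^2" "B1 = c1 * (r - s - \<eta> / g)^2 + c2 * B"
        by (simp_all only: A1_def A0_def B1_def P'_lin)
      have gen: "(1 - g - p) * (c1 * A + c2 * B) + p * (v * (c1 * a1 + c2 * a2) + (1 - v) * (c1 * A + c2 * a3))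
          + g * (u * (c1 * b1 + c2 * B) + (1 - u) * (c1 * A + c2 * B))
        = c1 * ((1 - g - p) * A + (v * (p * a1) + (1 - v) * (p * A)) + (u * (g * b1) + (1 - u) * (g * A)))
          + c2 * ((1 - g - p) * B + (v * (p * a2) + (1 - v) * (p * a3)) + g * B)" for a1 a2 a3 b1
        by (simp add: algebra_simps)
      show ?thesis unfolding eqs P'_lin by (rule gen)
    qed
    also have "\<dots> = P' A B + (c1 * 2 * \<eta> * ((r - s) * (v - u)) + c1 * \<eta>^2 * (v / p + u / g)
        - c2 * 2 * \<theta> * (q - t) * (1 - 2 * v) + c2 * \<theta>^2 / p)"
      unfolding X Y P'_lin by (simp add: algebra_simps)
    also have "\<dots> = P' A B + (p * ((r - s) * (v - u) + \<eta> / 2 * (v / p + u / g))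
      + (- (q - t) * (1 - 2 * v) + \<theta> / (2 * p))) / 2"
    proof -
      have c: "c1 * 2 * \<eta> = p / 2" "c1 * \<eta>^2 = p * \<eta> / 4" "c2 * 2 * \<theta> = 1 / 2" "c2 * \<theta>^2 = \<theta> / 4"
        using \<eta> by (simp_all add: c1_def c2_def power2_eq_square)
      show ?thesis unfolding c by (simp add: algebra_simps add_divide_distrib diff_divide_distrib)
    qed
    finally show ?thesis unfolding e a g .
  qed
  finally have 1: "\<pi> 0 * P (U (0, 0)) + \<pi> 1 * P (U (1, 0))
        + (\<Sum>a\<in>{2,3,4,5}. \<pi> a * (v * P (U (a, 1)) + (1 - v) * P (U (a, 0))))
        + \<pi> 6 * (u * P (U (6, 1)) + (1 - u) * P (U (6, 0))) \<le> \<dots>" .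
  have 2: "game_val \<pi> u v = ((1 - g - p) * min u v + p * (r * u + (1 - r) * v) + 2 * g
      + (1 - g) * (q * (1 - v) + (1 - q) * v)) / 2"
    by (simp add: game_val_def \<pi>_def ogd_strategy_def algebra_simps)
  \<comment> \<open>Action 6 pays no separate prediction loss, so the factor \<open>1 - g\<close>
    may be dropped.\<close>
  have 3: "(1 - g) * (q * (1 - v) + (1 - q) * v) \<le> q * (1 - v) + (1 - q) * v"
    using gp rq uv by (intro mult_left_le_one_le) auto
  have "v / p + u / g \<le> 1 / p + 1 / g"
    using uv gp by (intro add_mono divide_right_mono) auto
  then have 4: "p * (\<eta> / 2 * (v / p + u / g)) \<le> p * (\<eta> / 2 * (1 / p + 1 / g))"
    using gp \<eta> by (intro mult_left_mono) auto
  have 5: "P (r, q) = P' A B" by (simp add: P A_def B_def)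
  define c l y y' z w where "c = (1 - g - p) * min u v + p * (r * u + (1 - r) * v) + 2 * g"
    and "l = q * (1 - v) + (1 - q) * v" and "y = p * (\<eta> / 2 * (v / p + u / g))"
    and "y' = p * (\<eta> / 2 * (1 / p + 1 / g))" and "z = p * ((r - s) * (v - u))"
    and "w = - (q - t) * (1 - 2 * v) + \<theta> / (2 * p)"
  have "ogd_cost g p \<eta> \<theta> s t u v = (c + l + z + y' + w) / 2"
  proof -
    have "(a + p * (s * u + (1 - s) * v) + 2 * g + (t * (1 - v) + (1 - t) * v) + p * \<eta> / 2 * I + J) / 2
      = ((a + p * (r * u + (1 - r) * v) + 2 * g) + (q * (1 - v) + (1 - q) * v)
         + p * ((r - s) * (v - u)) + p * (\<eta> / 2 * I) + (- (q - t) * (1 - 2 * v) + J)) / 2" for a I J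
      by (simp add: algebra_simps)
    then show ?thesis
      unfolding ogd_cost_def c_def l_def z_def y'_def w_def .
  qed
  moreover have "p * ((r - s) * (v - u) + \<eta> / 2 * (v / p + u / g)) = z + y"
    unfolding z_def y_def by (rule distrib_left)
  ultimately show ?thesis
    using 1 2 3 4 unfolding 5 c_def[symmetric] l_def[symmetric] y_def[symmetric] y'_def[symmetric] w_def[symmetric]
    by argo
qed

text \<open>\<open>ogd_step\<close> telescopes along the play; the final potential is nonnegative
  and is discarded.\<close>

lemma ogd_exp_V:
  assumes gp: "0 < g" "0 < p" "g + p \<le> 1" and \<eta>: "0 < \<eta>" "0 < \<theta>"
    and st: "0 \<le> s" "s \<le> 1" "0 \<le> t" "t \<le> 1" and "set xs \<subseteq> prob_simplex 4"
  shows "exp_V 7 4 game_L game_S (ogd_learner g p \<eta> \<theta>) xs h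
    \<le> (\<Sum>x\<leftarrow>xs. ogd_cost g p \<eta> \<theta> s t (marg1 x) (marg2 x)) + ogd_pot p \<eta> \<theta> s t (ogd_state g p \<eta> \<theta> h)"
  using assms(10)
proof (induction xs arbitrary: h)
  case Nil
  then show ?case
    using gp \<eta> by (auto simp: ogd_pot_def split: prod.split)
next
  case (Cons x xs)
  define lr where "lr = ogd_learner g p \<eta> \<theta>"
  define C where "C = (\<Sum>x\<leftarrow>xs. ogd_cost g p \<eta> \<theta> s t (marg1 x) (marg2 x))"
  obtain r q where rq: "ogd_state g p \<eta> \<theta> h = (r, q)" by fastforce
  have rqb: "0 \<le> r" "r \<le> 1" "0 \<le> q" "q \<le> 1"
    using ogd_state_bounds[OF rq] by auto
  have x: "x \<in> prob_simplex 4" using Cons.prems by auto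
  have lrh: "lr h = ogd_strategy g p (r, q)"
    by (simp add: lr_def ogd_learner_def rq)
  have \<pi>: "lr h \<in> prob_simplex 7"
    unfolding lrh using gp rqb by (intro ogd_strategy_simplex) auto
  define W where "W = (\<lambda>a \<sigma>. ogd_pot p \<eta> \<theta> s t (upd g p \<eta> \<theta> (r, q) (a, \<sigma>)))"
  have "exp_V 7 4 game_L game_S lr (x # xs) h
      \<le> Vloss 7 4 game_L game_S (lr h) x + (\<Sum>a<7. \<Sum>z<4. lr h a * x z * (C + W a (game_S a z)))"
    unfolding exp_V.simps
  proof (intro add_left_mono sum_mono mult_left_mono)
    fix a z
    show "exp_V 7 4 game_L game_S lr xs (h @ [(a, game_S a z)]) \<le> C + W a (game_S a z)"
      using Cons.IH[of "h @ [(a, game_S a z)]"] Cons.prems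
      by (simp add: lr_def C_def W_def ogd_state_snoc rq)
    show "0 \<le> lr h a * x z"
      using simplex_7D(1)[OF \<pi>] simplex_4D(1)[OF x] by simp
  qed
  also have "\<dots> = C + (game_val (lr h) (marg1 x) (marg2 x)
     + (lr h 0 * W 0 0 + lr h 1 * W 1 0
        + (\<Sum>a\<in>{2,3,4,5}. lr h a * (marg2 x * W a 1 + (1 - marg2 x) * W a 0))
        + lr h 6 * (marg1 x * W 6 1 + (1 - marg1 x) * W 6 0)))"
  proof -
    have eq: "lr h 0 = 1 - (lr h 1 + lr h 2 + lr h 3 + lr h 4 + lr h 5 + lr h 6)"
      using simplex_7D(2)[OF \<pi>] by simp
    show ?thesis
      unfolding eq Vloss_game[OF \<pi> x] sum_signals_game[OF x, where W = "\<lambda>a \<sigma>. C + W a \<sigma>"]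
      by (simp add: algebra_simps)
  qed
  also have "\<dots> \<le> C + (ogd_cost g p \<eta> \<theta> s t (marg1 x) (marg2 x) + ogd_pot p \<eta> \<theta> s t (r, q))"
    unfolding W_def lrh by (intro add_left_mono ogd_step gp \<eta> rqb st marg_bounds x)
  finally show ?case
    by (simp add: lr_def C_def rq)
qed

text \<open>Because \<open>min\<close> is superadditive, paying it round by round is no worse than
  paying it at the average, so actions 0 and 1 need no information for their conjunction
  loss.\<close>

lemma sum_list_min_le:
  fixes f g :: "'a \<Rightarrow> real"
  shows "(\<Sum>x\<leftarrow>xs. min (f x) (g x)) \<le> min (\<Sum>x\<leftarrow>xs. f x) (\<Sum>x\<leftarrow>xs. g x)"
  by (induction xs) auto

lemma ogd_regret:
  assumes gp: "0 < g" "0 < p" "g + p \<le> 1" and \<eta>: "0 < \<eta>" "0 < \<theta>"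
    and xs: "set xs \<subseteq> prob_simplex 4" "xs \<noteq> []"
  shows "regret 7 4 game_L game_S (ogd_learner g p \<eta> \<theta>) xs
    \<le> real (length xs) * (g + (\<eta> + p * \<eta> / g + \<theta> / p) / 4) + p / (4 * \<eta>) + 1 / (4 * \<theta>)"
proof -
  define n u v where "n = real (length xs)" and "u = marg1 (avg xs)" and "v = marg2 (avg xs)"
  have a: "avg xs \<in> prob_simplex 4"
    using xs by (rule avg_in_simplex)
  have uv: "0 \<le> u" "u \<le> 1" "0 \<le> v" "v \<le> 1"
    using marg_bounds[OF a] by (auto simp: u_def v_def)
  have n: "0 \<le> n" by (simp add: n_def)
  \<comment> \<open>The best fixed choices in hindsight: pay for the less likely bit, predict the
    likelier value.\<close>
  define s t :: real where "s = of_bool (u \<le> v)" and "t = of_bool (1/2 \<le> v)"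
  have st: "0 \<le> s" "s \<le> 1" "0 \<le> t" "t \<le> 1" by (auto simp: s_def t_def)
  have s_eq: "s * u + (1 - s) * v = min u v" and t_eq: "t * (1 - v) + (1 - t) * v = min v (1 - v)"
    by (auto simp: s_def t_def)
  define K where "K = 2 * g + p * \<eta> / 2 * (1 / p + 1 / g) + \<theta> / (2 * p)"
  define M where "M = (\<Sum>x\<leftarrow>xs. min (marg1 x) (marg2 x))"
  have M: "M \<le> n * min u v"
    using sum_list_min_le[of marg1 marg2 xs] sum_list_marg[OF xs(2)] n
    by (simp add: M_def n_def u_def v_def min_mult_distrib_left)
  have "(\<Sum>x\<leftarrow>xs. ogd_cost g p \<eta> \<theta> s t (marg1 x) (marg2 x)) =
     ((1 - g - p) * M + p * (s * (\<Sum>x\<leftarrow>xs. marg1 x) + (1 - s) * (\<Sum>x\<leftarrow>xs. marg2 x))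
      + (t * (real (length xs) - (\<Sum>x\<leftarrow>xs. marg2 x)) + (1 - t) * (\<Sum>x\<leftarrow>xs. marg2 x)) + real (length xs) * K) / 2"
    unfolding M_def by (induction xs) (simp_all add: ogd_cost_def K_def algebra_simps add_divide_distrib diff_divide_distrib)
  also have "\<dots> = ((1 - g - p) * M + p * (n * (s * u + (1 - s) * v))
      + n * (t * (1 - v) + (1 - t) * v) + n * K) / 2"
    unfolding sum_list_marg[OF xs(2)] n_def u_def v_def by (simp add: algebra_simps)
  also have "\<dots> \<le> ((1 - g - p) * (n * min u v) + p * (n * min u v) + n * min v (1 - v) + n * K) / 2"
    unfolding s_eq t_eq using gp M n by (intro divide_right_mono add_mono mult_left_mono) auto
  also have "\<dots> = n * game_opt u v + n * K / 2 - g * (n * min u v) / 2"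
    by (simp add: game_opt_def algebra_simps add_divide_distrib diff_divide_distrib)
  also have "\<dots> \<le> n * game_opt u v + n * K / 2"
    using gp n uv by simp
  finally have c: "(\<Sum>x\<leftarrow>xs. ogd_cost g p \<eta> \<theta> s t (marg1 x) (marg2 x)) \<le> n * game_opt u v + n * K / 2" .
  have "(1/2 - s)^2 \<le> 1" "(1/2 - t)^2 \<le> 1"
    by (auto simp: s_def t_def power2_eq_square)
  then have "p * (1/2 - s)^2 / (2 * \<eta>) \<le> p * 1 / (2 * \<eta>)" "(1/2 - t)^2 / (2 * \<theta>) \<le> 1 / (2 * \<theta>)"
    using gp \<eta> by (intro divide_right_mono mult_left_mono; simp)+
  then have "ogd_pot p \<eta> \<theta> s t (ogd_state g p \<eta> \<theta> []) \<le> p / (4 * \<eta>) + 1 / (4 * \<theta>)"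
    by (simp add: ogd_pot_def ogd_state_def)
  moreover have V: "Vstar 7 4 game_L game_S (avg xs) = game_opt u v"
    unfolding u_def v_def by (rule Vstar_game[OF a])
  moreover have K: "n * K / 2 = n * (g + (\<eta> + p * \<eta> / g + \<theta> / p) / 4)"
  proof -
    have "p * \<eta> / 2 * (1 / p + 1 / g) = \<eta> / 2 + p * \<eta> / g / 2"
      using gp by (simp add: distrib_left)
    then have "K = 2 * (g + (\<eta> + p * \<eta> / g + \<theta> / p) / 4)"
      by (simp add: K_def)
    then show ?thesis by simp
  qed
  moreover have "exp_V 7 4 game_L game_S (ogd_learner g p \<eta> \<theta>) xs []
      \<le> (\<Sum>x\<leftarrow>xs. ogd_cost g p \<eta> \<theta> s t (marg1 x) (marg2 x)) + ogd_pot p \<eta> \<theta> s t (ogd_state g p \<eta> \<theta> [])"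
    by (rule ogd_exp_V[OF gp \<eta> st xs(1)])
  ultimately show ?thesis
    using c unfolding regret_def V n_def[symmetric] K[symmetric] by argo
qed

section \<open>Balancing the parameters and passing to the limit\<close>

lemma minimax_regret_upper:
  assumes n: "0 < n"
  shows "minimax_regret 7 4 game_L game_S n \<le> 2 * real n powr (4/7)"
proof -
  define N where "N = real n powr (1/7)"
  have N: "1 \<le> N" and N7: "N ^ 7 = real n" and N4: "N ^ 4 = real n powr (4/7)"
    using n by (auto simp: N_def ge_one_powr_ge_zero powr_power)
  \<comment> \<open>The step sizes have the orders \<open>sqrt (g / n)\<close> and
    \<open>sqrt (p / n)\<close> that balance each squared-distance term with its second moment. The
    factors 2 ensure \<open>g + p \<le> 1\<close>.\<close>
  define g p \<eta> \<theta> where "g = 1 / (2 * N ^ 3)" and "p = 1 / (2 * N)" and "\<eta> = 1 / N ^ 5" and "\<theta> = 1 / N ^ 4"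
  have "1 / (2 * N ^ 3) \<le> 1 / 2" "1 / (2 * N) \<le> 1 / 2"
    using N by (auto simp: field_simps)
  then have gp: "0 < g" "0 < p" "g + p \<le> 1"
    using N unfolding g_def p_def by (simp, simp, linarith)
  have \<eta>: "0 < \<eta>" "0 < \<theta>" using N by (auto simp: \<eta>_def \<theta>_def)
  have "N ^ 2 \<le> N ^ 4" using N by (intro power_increasing) auto
  define lr where "lr = ogd_learner g p \<eta> \<theta>"
  have lr: "valid_learner 7 lr"
    unfolding lr_def using gp by (intro valid_ogd_learner) auto
  have "N ^ 7 * g = N ^ 4 / 2" "N ^ 7 * \<eta> = N ^ 2" "N ^ 7 * (p * \<eta> / g) = N ^ 4"
    "N ^ 7 * (\<theta> / p) = 2 * N ^ 4" "p / (4 * \<eta>) = N ^ 4 / 8" "1 / (4 * \<theta>) = N ^ 4 / 4"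
    using N by (simp_all add: g_def p_def \<eta>_def \<theta>_def divide_simps eval_nat_numeral)
  then have "real n * (g + (\<eta> + p * \<eta> / g + \<theta> / p) / 4) + p / (4 * \<eta>) + 1 / (4 * \<theta>)
      = N ^ 4 / 2 + (N ^ 2 + 3 * N ^ 4) / 4 + N ^ 4 / 8 + N ^ 4 / 4"
    unfolding N7[symmetric] distrib_left times_divide_eq_right[symmetric, where c = 4] by argo
  also have "\<dots> \<le> 2 * N ^ 4" using \<open>N ^ 2 \<le> N ^ 4\<close> zero_le_power2[of N] by argo
  finally have bound: "regret 7 4 game_L game_S lr xs \<le> 2 * N ^ 4"
    if "length xs = n" "set xs \<subseteq> prob_simplex 4" for xs
    using ogd_regret[OF gp \<eta>, of xs] that n by (auto simp: lr_def)
  \<comment> \<open>The real \<open>INF\<close> lies below the value of a particular learner only if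
    the values are bounded below, which the lower bound supplies.\<close>
  have "bdd_below ((\<lambda>lr. SUP xs \<in> {xs. length xs = n \<and> set xs \<subseteq> prob_simplex 4}.
      regret 7 4 game_L game_S lr xs) ` {lr. valid_learner 7 lr})"
    by (rule bdd_belowI2) (use regret_lower[OF _ n] in blast)
  then have "minimax_regret 7 4 game_L game_S n \<le>
      (SUP xs \<in> {xs. length xs = n \<and> set xs \<subseteq> prob_simplex 4}. regret 7 4 game_L game_S lr xs)"
    unfolding minimax_regret_def using lr by (intro cINF_lower) auto
  also have "\<dots> \<le> 2 * N ^ 4"
  proof (rule cSUP_least)
    have "replicate n (indep_bits 0 0) \<in> {xs. length xs = n \<and> set xs \<subseteq> prob_simplex 4}"
      using indep_bits_simplex[of 0 0] by auto
    then show "{xs. length xs = n \<and> set xs \<subseteq> prob_simplex 4} \<noteq> {}" by blast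
  qed (use bound in auto)
  finally show ?thesis by (simp add: N4)
qed

lemma minimax_regret_lower:
  assumes "0 < n"
  shows "real n powr (4/7) / 64 \<le> minimax_regret 7 4 game_L game_S n"
  unfolding minimax_regret_def
proof (rule cINF_greatest)
  have "valid_learner 7 (ogd_learner 0 0 0 0)"
    by (rule valid_ogd_learner) auto
  then show "{lr. valid_learner 7 lr} \<noteq> {}" by blast
qed (use regret_lower[OF _ assms] in auto)

theorem theorem3:
  shows "\<exists>(k::nat) (m::nat) (L::nat \<Rightarrow> nat \<Rightarrow> real) (S::nat \<Rightarrow> nat \<Rightarrow> nat).
           1 \<le> k \<and> 1 \<le> m \<and> (\<forall>a z. 0 \<le> L a z \<and> L a z \<le> 1) \<and>
           limsup (\<lambda>n. ereal (ln (minimax_regret k m L S n) / ln (real n))) = ereal (4/7)"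
proof -
  define R where "R = minimax_regret 7 4 game_L game_S"
  \<comment> \<open>The two bounds share the exponent and their constants vanish after division by
    \<open>ln n\<close>, so a full limit exists. Restricting to \<open>2 \<le> n\<close> keeps
    \<open>ln n\<close> positive.\<close>
  have "(\<lambda>n. ln (R n) / ln (real n)) \<longlonglongrightarrow> 4/7"
  proof (rule tendsto_sandwich)
    have *: "real n powr (4/7) / 64 \<le> R n" "R n \<le> 2 * real n powr (4/7)" "0 < ln (real n)"
      if "2 \<le> n" for n
      using minimax_regret_lower[of n] minimax_regret_upper[of n] that by (auto simp: R_def)
    show "\<forall>\<^sub>F n in sequentially. ln (real n powr (4/7) / 64) / ln (real n) \<le> ln (R n) / ln (real n)"
      using eventually_ge_at_top[of 2]
    proof eventually_elim
      case (elim n)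
      have "0 < real n powr (4/7) / 64" using elim by simp
      then have "ln (real n powr (4/7) / 64) \<le> ln (R n)"
        using *(1)[OF elim] by (intro ln_mono) auto
      then show ?case using *(3)[OF elim] by (intro divide_right_mono) auto
    qed
    show "\<forall>\<^sub>F n in sequentially. ln (R n) / ln (real n) \<le> ln (2 * real n powr (4/7)) / ln (real n)"
      using eventually_ge_at_top[of 2]
    proof eventually_elim
      case (elim n)
      have "0 < real n powr (4/7) / 64" using elim by simp
      then have "0 < R n"
        using *(1)[OF elim] by (rule less_le_trans)
      then have "ln (R n) \<le> ln (2 * real n powr (4/7))"
        using *(2)[OF elim] by (intro ln_mono) auto
      then show ?case using *(3)[OF elim] by (intro divide_right_mono) auto
    qed
    show "(\<lambda>n. ln (real n powr (4/7) / 64) / ln (real n)) \<longlonglongrightarrow> 4/7"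
      by real_asymp
    show "(\<lambda>n. ln (2 * real n powr (4/7)) / ln (real n)) \<longlonglongrightarrow> 4/7"
      by real_asymp
  qed
  then have "limsup (\<lambda>n. ereal (ln (R n) / ln (real n))) = ereal (4/7)"
    by (intro lim_imp_Limsup) (auto intro: tendsto_intros)
  then show ?thesis
    using game_L_bounds unfolding R_def
    by (intro exI[of _ 7] exI[of _ 4] exI[of _ game_L] exI[of _ game_S]) auto
qed

end
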